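(* There is a bijective correspondence between the collection of all troupes and the collection of all sets of branches (i.e. all subsets of $\mathsf{Branch}$). Under this correspondence, a troupe $\mathbf T$ corresponds to $\mathbf T\cap\mathsf{Branch}$, and a set $B$ of branches corresponds to its insertion closure $\overline{\mathrm{Ins}}(B)$. (That is, $\mathbf T\mapsto \mathbf T\cap\mathsf{Branch}$ and $B\mapsto\overline{\mathrm{Ins}}(B)$ are mutually inverse bijections.)
   Context: Fix a finite set $\mathbf C$ of colors containing black and white. A binary plane tree is a finite (possibly empty) rooted tree in which every vertex has at most two children, every child is designated as either a left child or a right child (not both), and no vertex has two left children or two right children. A colored binary plane tree is a binary plane tree together with a function from its vertex set to $\mathbf C$. Trees are considered up to isomorphism; $\mathsf{CBPT}$ is the set of colored binary plane trees. Insertion: let $T_1,T_2\in\mathsf{CBPT}$ be nonempty and $v$ a vertex of $T_1$. Replace $v$ by two vertices joined by a left edge: the lower one is still called $v$ (it keeps the color of $v$ and the left/right subtrees of $v$), and the upper one, called $v^*$, is colored black, takes the place of $v$ with respect to the parent of $v$ (if any), and has $v$ as its left child. Then attach $T_2$ as the right subtree of $v^*$. The result is $\nabla_v(T_1,T_2)$. Decomposition: let $T\in\mathsf{CBPT}$ and let $v^*$ be a black vertex of $T$ with $2$ children. Let $v$ be the left child of $v^*$ and $T_2$ the right subtree of $v^*$. Delete $T_2$ from $T$ and contract the edge between $v$ and $v^*$ into a single vertex, which is identified with $v$ (keeping the color of $v$), to get $T_1$. Then $\Delta_{v^*}(T)=(T_1,T_2)$. A set $\mathbf T\subseteq\mathsf{CBPT}$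 is insertion-closed if $\nabla_v(T_1,T_2)\in\mathbf T$ for all nonempty $T_1,T_2\in\mathbf T$ and every vertex $v$ of $T_1$; decomposition-closed if $\Delta_{v^*}(T)\in\mathbf T\times\mathbf T$ for every $T\in\mathbf T$ and every black vertex $v^*$ of $T$ with $2$ children; black-peaked if in every $T\in\mathbf T$ all vertices with $2$ children are black. A troupe is a set $\mathbf T\subseteq\mathsf{CBPT}$ that is insertion-closed, decomposition-closed, and black-peaked. The insertion closure $\overline{\mathrm{Ins}}(\mathbf T)$ of $\mathbf T\subseteq\mathsf{CBPT}$ is the smallest (under containment) insertion-closed subset of $\mathsf{CBPT}$ containing $\mathbf T$. A branch is a colored binary plane tree in which no vertex has $2$ children; $\mathsf{Branch}$ is the set of all branches. *)

theory Defs
  imports "HOL-Library.Tree"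
begin

text \<open>
  Isomorphism classes of colored binary plane trees are elements of the type \<^typ>\<open>'c tree\<close>:
  \<^term>\<open>\<langle>\<rangle>\<close> is the empty tree, and \<^term>\<open>\<langle>l, c, r\<rangle>\<close> has a root of color \<^term>\<open>c\<close>, where an empty
  \<^term>\<open>l\<close> (or \<^term>\<open>r\<close>) means that the root has no left (or no right) child.
  A vertex is identified with the sequence of left and right steps leading to it from the root.
\<close>

datatype side = Lft | Rgt

type_synonym vertex = "side list"

fun subtree_at :: "'c tree \<Rightarrow> vertex \<Rightarrow> 'c tree" where
  "subtree_at t [] = t"
| "subtree_at \<langle>\<rangle> (d # v) = \<langle>\<rangle>"
| "subtree_at \<langle>l, c, r\<rangle> (Lft # v) = subtree_at l v"
| "subtree_at \<langle>l, c, r\<rangle> (Rgt # v) = subtree_at r v"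

fun replace_at :: "'c tree \<Rightarrow> vertex \<Rightarrow> 'c tree \<Rightarrow> 'c tree" where
  "replace_at t [] s = s"
| "replace_at \<langle>\<rangle> (d # v) s = \<langle>\<rangle>"
| "replace_at \<langle>l, c, r\<rangle> (Lft # v) s = \<langle>replace_at l v s, c, r\<rangle>"
| "replace_at \<langle>l, c, r\<rangle> (Rgt # v) s = \<langle>l, c, replace_at r v s\<rangle>"

definition vertices :: "'c tree \<Rightarrow> vertex set" where
  "vertices t = {v. subtree_at t v \<noteq> \<langle>\<rangle>}"

definition color_at :: "'c tree \<Rightarrow> vertex \<Rightarrow> 'c" where
  "color_at t v = value (subtree_at t v)"

definition children :: "'c tree \<Rightarrow> vertex \<Rightarrow> vertex set" where
  "children t v = {w \<in> vertices t. \<exists>d. w = v @ [d]}"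

definition CBPT :: "'c set \<Rightarrow> 'c tree set" where
  "CBPT C = {t. set_tree t \<subseteq> C}"

text \<open>
  In \<^term>\<open>insertion black v t1 t2\<close> the new black vertex takes over the address \<^term>\<open>v\<close>, and
  the old vertex moves to the address \<^term>\<open>v @ [Lft]\<close>, keeping its color and subtrees.
\<close>

definition insertion :: "'c \<Rightarrow> vertex \<Rightarrow> 'c tree \<Rightarrow> 'c tree \<Rightarrow> 'c tree" where
  "insertion black v t1 t2 = replace_at t1 v \<langle>subtree_at t1 v, black, t2\<rangle>"

text \<open>
  Removing the right subtree of \<^term>\<open>v\<close> and contracting the edge from \<^term>\<open>v\<close> to its left child
  (keeping the color of the child) leaves the left subtree of \<^term>\<open>v\<close> in the place of \<^term>\<open>v\<close>.
\<close>

definition decomposition :: "vertex \<Rightarrow> 'c tree \<Rightarrow> 'c tree \<times> 'c tree" where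
  "decomposition v t =
     (replace_at t v (subtree_at t (v @ [Lft])), subtree_at t (v @ [Rgt]))"

definition insertion_closed :: "'c \<Rightarrow> 'c tree set \<Rightarrow> bool" where
  "insertion_closed black T \<longleftrightarrow>
     (\<forall>t1 \<in> T. \<forall>t2 \<in> T. t1 \<noteq> \<langle>\<rangle> \<longrightarrow> t2 \<noteq> \<langle>\<rangle> \<longrightarrow>
        (\<forall>v \<in> vertices t1. insertion black v t1 t2 \<in> T))"

definition decomposition_closed :: "'c \<Rightarrow> 'c tree set \<Rightarrow> bool" where
  "decomposition_closed black T \<longleftrightarrow>
     (\<forall>t \<in> T. \<forall>v \<in> vertices t. color_at t v = black \<longrightarrow> card (children t v) = 2 \<longrightarrow>
        decomposition v t \<in> T \<times> T)"

definition black_peaked :: "'c \<Rightarrow> 'c tree set \<Rightarrow> bool" where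
  "black_peaked black T \<longleftrightarrow>
     (\<forall>t \<in> T. \<forall>v \<in> vertices t. card (children t v) = 2 \<longrightarrow> color_at t v = black)"

definition troupe :: "'c set \<Rightarrow> 'c \<Rightarrow> 'c tree set \<Rightarrow> bool" where
  "troupe C black T \<longleftrightarrow>
     T \<subseteq> CBPT C \<and> insertion_closed black T \<and> decomposition_closed black T \<and> black_peaked black T"

definition insertion_closure :: "'c set \<Rightarrow> 'c \<Rightarrow> 'c tree set \<Rightarrow> 'c tree set" where
  "insertion_closure C black T =
     \<Inter> {S. S \<subseteq> CBPT C \<and> insertion_closed black S \<and> T \<subseteq> S}"

text \<open>The empty tree is a branch.\<close>

definition Branch :: "'c set \<Rightarrow> 'c tree set" where
  "Branch C = {t \<in> CBPT C. \<forall>v \<in> vertices t. card (children t v) \<noteq> 2}"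

end

theory Submission
  imports Defs
begin

text \<open>
  Cutting every vertex with two children off from its right subtree, and contracting it into its
  left child, breaks a tree \<^term>\<open>t\<close> into a set of branches, its \<^emph>\<open>branch components\<close>. The point of
  the proof is that this set does not depend on the order of the cuts, so it can be computed by
  structural recursion, and insertion merely takes unions:
  the components of \<open>\<nabla>\<^sub>v(t\<^sub>1, t\<^sub>2)\<close> are those of \<open>t\<^sub>1\<close> together with those of \<open>t\<^sub>2\<close>
  (\<open>branch_components_insertion\<close>). The same holds for the set of colors of the vertices with two
  children, except that black is added (\<open>peak_colors_insertion\<close>).

  Given a set \<open>B\<close> of branches, consider the black-peaked trees all of whose components lie in \<open>B\<close>.
  By the two union formulas they are closed under insertion, and, because \<open>\<nabla>\<close> undoes \<open>\<Delta>\<close>, also under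
  decomposition: they form a troupe. As the only component of a branch is the branch itself, the
  branches in this troupe are exactly the elements of \<open>B\<close>.

  Conversely, a troupe \<open>T\<close> is generated by its branches: any other tree in \<open>T\<close> has a vertex with
  two children, necessarily black, and is obtained by insertion from the two smaller trees into
  which it decomposes there. Applied to the troupe constructed from \<open>B\<close>, this identifies that
  troupe with the insertion closure of \<open>B\<close>.
\<close>

section \<open>Addresses and vertices with two children\<close>

lemma subtree_at_Leaf [simp]: "subtree_at \<langle>\<rangle> v = \<langle>\<rangle>"
  by (cases v) auto

lemma subtree_at_append: "subtree_at t (v @ w) = subtree_at (subtree_at t v) w"
  by (induction t v rule: subtree_at.induct) auto

lemma subtree_at_replace_at:
  "v \<in> vertices t \<Longrightarrow> subtree_at (replace_at t v s) v = s"
  by (induction t v s rule: replace_at.induct) (auto simp: vertices_def)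

lemma replace_at_replace_at: "replace_at (replace_at t v s) v s' = replace_at t v s'"
  by (induction t v s rule: replace_at.induct) auto

lemma replace_at_subtree_at: "replace_at t v (subtree_at t v) = t"
  by (induction t v rule: subtree_at.induct) auto

lemma vertices_Leaf [simp]: "vertices \<langle>\<rangle> = {}"
  by (simp add: vertices_def)

lemma vertices_Node [simp]:
  "[] \<in> vertices \<langle>l, c, r\<rangle>"
  "Lft # v \<in> vertices \<langle>l, c, r\<rangle> \<longleftrightarrow> v \<in> vertices l"
  "Rgt # v \<in> vertices \<langle>l, c, r\<rangle> \<longleftrightarrow> v \<in> vertices r"
  by (auto simp: vertices_def)

lemma card_children_eq_2_iff:
  "card (children t v) = 2 \<longleftrightarrow> (\<exists>l c r. subtree_at t v = \<langle>l, c, r\<rangle> \<and> l \<noteq> \<langle>\<rangle> \<and> r \<noteq> \<langle>\<rangle>)"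
proof -
  have children: "children t v =
      (if subtree_at t (v @ [Lft]) \<noteq> \<langle>\<rangle> then {v @ [Lft]} else {}) \<union>
      (if subtree_at t (v @ [Rgt]) \<noteq> \<langle>\<rangle> then {v @ [Rgt]} else {})"
    by (auto simp: children_def vertices_def) (metis side.exhaust)+
  show ?thesis
    unfolding children by (cases "subtree_at t v") (auto simp: subtree_at_append)
qed

fun peak_colors :: "'c tree \<Rightarrow> 'c set" where
  "peak_colors \<langle>\<rangle> = {}"
| "peak_colors \<langle>l, c, r\<rangle> =
     peak_colors l \<union> peak_colors r \<union> (if l \<noteq> \<langle>\<rangle> \<and> r \<noteq> \<langle>\<rangle> then {c} else {})"

lemma peak_color_subtree_at:
  "subtree_at t v = \<langle>l, c, r\<rangle> \<Longrightarrow> l \<noteq> \<langle>\<rangle> \<Longrightarrow> r \<noteq> \<langle>\<rangle> \<Longrightarrow> c \<in> peak_colors t"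
  by (induction t v rule: subtree_at.induct) auto

lemma peak_color_obtains_vertex:
  assumes "c \<in> peak_colors t"
  shows "\<exists>v l r. subtree_at t v = \<langle>l, c, r\<rangle> \<and> l \<noteq> \<langle>\<rangle> \<and> r \<noteq> \<langle>\<rangle>"
  using assms
proof (induction t)
  case Leaf
  then show ?case by simp
next
  case (Node l d r)
  then consider "c \<in> peak_colors l" | "c \<in> peak_colors r" | "c = d" "l \<noteq> \<langle>\<rangle>" "r \<noteq> \<langle>\<rangle>"
    by (auto split: if_splits)
  then show ?case
  proof cases
    case 1
    then show ?thesis using Node.IH(1) subtree_at.simps(3) by metis
  next
    case 2
    then show ?thesis using Node.IH(2) subtree_at.simps(4) by metis
  next
    case 3
    then show ?thesis using subtree_at.simps(1) by metis
  qed
qed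

lemma peak_colors_eq:
  "peak_colors t = {color_at t v | v. v \<in> vertices t \<and> card (children t v) = 2}"
proof (intro set_eqI iffI)
  fix c
  assume "c \<in> peak_colors t"
  then obtain v l r where v: "subtree_at t v = \<langle>l, c, r\<rangle>" "l \<noteq> \<langle>\<rangle>" "r \<noteq> \<langle>\<rangle>"
    using peak_color_obtains_vertex by metis
  then have "v \<in> vertices t" "card (children t v) = 2" "c = color_at t v"
    by (auto simp: vertices_def card_children_eq_2_iff color_at_def)
  then show "c \<in> {color_at t v | v. v \<in> vertices t \<and> card (children t v) = 2}"
    by blast
next
  fix c
  assume "c \<in> {color_at t v | v. v \<in> vertices t \<and> card (children t v) = 2}"
  then show "c \<in> peak_colors t"
    by (auto simp: card_children_eq_2_iff color_at_def intro: peak_color_subtree_at)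
qed

lemma black_peaked_iff: "black_peaked black T \<longleftrightarrow> (\<forall>t \<in> T. peak_colors t \<subseteq> {black})"
  by (auto simp: black_peaked_def peak_colors_eq)

lemma Branch_iff: "t \<in> Branch C \<longleftrightarrow> t \<in> CBPT C \<and> peak_colors t = {}"
  by (auto simp: Branch_def peak_colors_eq)

section \<open>Insertion and decomposition\<close>

lemma insertion_simps [simp]:
  "insertion black [] t s = \<langle>t, black, s\<rangle>"
  "insertion black (Lft # v) \<langle>l, c, r\<rangle> s = \<langle>insertion black v l s, c, r\<rangle>"
  "insertion black (Rgt # v) \<langle>l, c, r\<rangle> s = \<langle>l, c, insertion black v r s\<rangle>"
  by (auto simp: insertion_def)

lemma insertion_eq_Leaf_iff [simp]:
  "v \<in> vertices t \<Longrightarrow> insertion black v t s = \<langle>\<rangle> \<longleftrightarrow> t = \<langle>\<rangle>"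
  by (induction t v rule: subtree_at.induct) auto

lemma size_insertion:
  "v \<in> vertices t \<Longrightarrow> size (insertion black v t s) = size t + size s + 1"
  by (induction t v rule: subtree_at.induct) auto

lemma set_tree_insertion:
  "v \<in> vertices t \<Longrightarrow> set_tree (insertion black v t s) = insert black (set_tree t \<union> set_tree s)"
  by (induction t v rule: subtree_at.induct) auto

lemma peak_colors_insertion:
  assumes "v \<in> vertices t" "s \<noteq> \<langle>\<rangle>"
  shows "peak_colors (insertion black v t s) = insert black (peak_colors t \<union> peak_colors s)"
  using assms by (induction t v rule: subtree_at.induct) auto

text \<open>
  Cutting at a vertex with two children is reversed by an insertion. Hence whatever is known about
  the result of an insertion transfers to decompositions. The left child is what keeps the address
  \<open>v\<close> occupied after the cut.
\<close>

lemma insertion_decomposition: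
  assumes v: "subtree_at t v = \<langle>l, c, r\<rangle>" and l: "l \<noteq> \<langle>\<rangle>"
    and dec: "decomposition v t = (t1, t2)"
  shows "t2 = r" and "v \<in> vertices t1" and "insertion c v t1 t2 = t"
proof -
  have t1: "t1 = replace_at t v l" and t2: "t2 = r"
    using dec v by (auto simp: decomposition_def subtree_at_append)
  have "v \<in> vertices t"
    using v by (simp add: vertices_def)
  then have sub: "subtree_at t1 v = l"
    by (simp add: t1 subtree_at_replace_at)
  show "t2 = r"
    by (fact t2)
  show "v \<in> vertices t1"
    using sub l by (simp add: vertices_def)
  have "insertion c v t1 t2 = replace_at t v (subtree_at t v)"
    by (simp add: insertion_def sub t2 v) (simp add: t1 replace_at_replace_at)
  then show "insertion c v t1 t2 = t"
    by (simp add: replace_at_subtree_at)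
qed

section \<open>Branch components\<close>

text \<open>
  The branch component that contains the root once all cuts and contractions are made. The empty tree
  counts as its own component, so that membership of the empty branch is recorded as well.
\<close>

fun root_branch :: "'c tree \<Rightarrow> 'c tree" where
  "root_branch \<langle>\<rangle> = \<langle>\<rangle>"
| "root_branch \<langle>l, c, r\<rangle> =
     (if l \<noteq> \<langle>\<rangle> \<and> r \<noteq> \<langle>\<rangle> then root_branch l else \<langle>root_branch l, c, root_branch r\<rangle>)"

text \<open>
  Every right subtree that is cut off contributes its own root component, so these are the
  components other than the one containing the root.
\<close>

fun cut_branches :: "'c tree \<Rightarrow> 'c tree set" where
  "cut_branches \<langle>\<rangle> = {}"
| "cut_branches \<langle>l, c, r\<rangle> =
     cut_branches l \<union> cut_branches r \<union> (if l \<noteq> \<langle>\<rangle> \<and> r \<noteq> \<langle>\<rangle> then {root_branch r} else {})"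

definition branch_components :: "'c tree \<Rightarrow> 'c tree set" where
  "branch_components t = insert (root_branch t) (cut_branches t)"

text \<open>
  The upper of the two vertices that replace \<open>v\<close> is contracted back into \<open>v\<close>, so the component
  of the root survives an insertion.
\<close>

lemma root_branch_insertion:
  assumes "v \<in> vertices t" "s \<noteq> \<langle>\<rangle>"
  shows "root_branch (insertion black v t s) = root_branch t"
  using assms by (induction t v rule: subtree_at.induct) auto

lemma cut_branches_insertion:
  assumes "v \<in> vertices t" "s \<noteq> \<langle>\<rangle>"
  shows "cut_branches (insertion black v t s) = cut_branches t \<union> branch_components s"
  using assms
  by (induction t v rule: subtree_at.induct) (auto simp: root_branch_insertion branch_components_def)

lemma branch_components_insertion:
  assumes "v \<in> vertices t" "s \<noteq> \<langle>\<rangle>"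
  shows "branch_components (insertion black v t s) = branch_components t \<union> branch_components s"
  using assms by (auto simp: branch_components_def root_branch_insertion cut_branches_insertion)

lemma branch_components_branch:
  assumes "peak_colors t = {}"
  shows "branch_components t = {t}"
proof -
  have "root_branch t = t \<and> cut_branches t = {}"
    using assms by (induction t) (auto split: if_splits)
  then show ?thesis
    by (simp add: branch_components_def)
qed

section \<open>Troupes and sets of branches\<close>

definition troupe_of :: "'c set \<Rightarrow> 'c \<Rightarrow> 'c tree set \<Rightarrow> 'c tree set" where
  "troupe_of C black B = {t \<in> CBPT C. peak_colors t \<subseteq> {black} \<and> branch_components t \<subseteq> B}"

text \<open>
  The equivalence yields closure under insertion from right to left and closure under decomposition
  from left to right.
\<close>

lemma insertion_in_troupe_of_iff:
  assumes "black \<in> C" "v \<in> vertices t" "s \<noteq> \<langle>\<rangle>"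
  shows "insertion black v t s \<in> troupe_of C black B \<longleftrightarrow>
         t \<in> troupe_of C black B \<and> s \<in> troupe_of C black B"
  using assms
  by (auto simp: troupe_of_def CBPT_def set_tree_insertion peak_colors_insertion
      branch_components_insertion)

lemma troupe_troupe_of:
  assumes "black \<in> C"
  shows "troupe C black (troupe_of C black B)"
  unfolding troupe_def
proof (intro conjI)
  show "troupe_of C black B \<subseteq> CBPT C" "black_peaked black (troupe_of C black B)"
    by (auto simp: troupe_of_def black_peaked_iff)
  show "insertion_closed black (troupe_of C black B)"
    using assms by (simp add: insertion_closed_def insertion_in_troupe_of_iff)
  show "decomposition_closed black (troupe_of C black B)"
    unfolding decomposition_closed_def
  proof (intro ballI impI)
    fix t v
    assume t: "t \<in> troupe_of C black B"
      and v: "color_at t v = black" "card (children t v) = 2"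
    then obtain l r where sub: "subtree_at t v = \<langle>l, black, r\<rangle>" "l \<noteq> \<langle>\<rangle>" "r \<noteq> \<langle>\<rangle>"
      by (auto simp: card_children_eq_2_iff color_at_def)
    obtain t1 t2 where dec: "decomposition v t = (t1, t2)"
      by fastforce
    note ins = insertion_decomposition[OF sub(1,2) dec]
    show "decomposition v t \<in> troupe_of C black B \<times> troupe_of C black B"
      using insertion_in_troupe_of_iff[OF assms ins(2), of t2 B] t ins sub(3) dec by simp
  qed
qed

lemma troupe_of_Int_Branch:
  assumes "B \<subseteq> Branch C"
  shows "troupe_of C black B \<inter> Branch C = B"
  using assms by (auto simp: troupe_of_def Branch_iff branch_components_branch)

text \<open>
  The closure lies in the troupe because troupes are themselves insertion-closed. For the other
  inclusion, a tree that is not a branch is rebuilt from the two trees into which the troupe's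
  decomposition-closedness lets it be split; both are smaller, since an insertion adds their sizes
  and one more vertex.
\<close>

lemma insertion_closure_troupe_Int_Branch:
  assumes T: "troupe C black T"
  shows "insertion_closure C black (T \<inter> Branch C) = T"
proof
  show "insertion_closure C black (T \<inter> Branch C) \<subseteq> T"
    using T by (auto simp: insertion_closure_def troupe_def)
  have "t \<in> S"
    if S: "insertion_closed black S" "T \<inter> Branch C \<subseteq> S" and "t \<in> T" for S t
    using \<open>t \<in> T\<close>
  proof (induction t rule: measure_induct_rule[of size])
    case (less t)
    show ?case
    proof (cases "t \<in> Branch C")
      case True
      then show ?thesis using less.prems S by blast
    next
      case False
      then obtain v where v: "v \<in> vertices t" "card (children t v) = 2"
        using less.prems T by (auto simp: Branch_def troupe_def)
      then have black: "color_at t v = black"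
        using less.prems T by (auto simp: troupe_def black_peaked_def)
      with v obtain l r where sub: "subtree_at t v = \<langle>l, black, r\<rangle>" "l \<noteq> \<langle>\<rangle>" "r \<noteq> \<langle>\<rangle>"
        by (auto simp: card_children_eq_2_iff color_at_def)
      obtain t1 t2 where dec: "decomposition v t = (t1, t2)"
        by fastforce
      note ins = insertion_decomposition[OF sub(1,2) dec]
      have "decomposition v t \<in> T \<times> T"
        using T less.prems v black by (auto simp: troupe_def decomposition_closed_def)
      then have "t1 \<in> T" "t2 \<in> T"
        using dec by auto
      moreover have "size t1 < size t" "size t2 < size t"
        using size_insertion[OF ins(2), of black t2] ins(3) by auto
      ultimately have "t1 \<in> S" "t2 \<in> S"
        using less.IH by auto
      moreover have "t1 \<noteq> \<langle>\<rangle>" "t2 \<noteq> \<langle>\<rangle>"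
        using ins(1,2) sub(3) by auto
      ultimately show ?thesis
        using S(1) ins(2,3) unfolding insertion_closed_def by metis
    qed
  qed
  then show "T \<subseteq> insertion_closure C black (T \<inter> Branch C)"
    by (auto simp: insertion_closure_def)
qed

lemma insertion_closure_eq_troupe_of:
  assumes "black \<in> C" "B \<subseteq> Branch C"
  shows "insertion_closure C black B = troupe_of C black B"
  using insertion_closure_troupe_Int_Branch[OF troupe_troupe_of[OF assms(1)], of B]
    troupe_of_Int_Branch[OF assms(2)] by simp

theorem theorem2p3:
  fixes C :: "'c set" and black white :: 'c
  assumes "finite C" and "black \<in> C" and "white \<in> C" and "black \<noteq> white"
  shows "bij_betw (\<lambda>T. T \<inter> Branch C) {T. troupe C black T} (Pow (Branch C))
       \<and> bij_betw (insertion_closure C black) (Pow (Branch C)) {T. troupe C black T}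
       \<and> (\<forall>T. troupe C black T \<longrightarrow> insertion_closure C black (T \<inter> Branch C) = T)
       \<and> (\<forall>B. B \<subseteq> Branch C \<longrightarrow> insertion_closure C black B \<inter> Branch C = B)"
proof -
  have troupe: "troupe C black (insertion_closure C black B)"
    and branches: "insertion_closure C black B \<inter> Branch C = B" if "B \<subseteq> Branch C" for B
    using that assms(2)
    by (simp_all add: insertion_closure_eq_troupe_of troupe_troupe_of troupe_of_Int_Branch)
  note closure = insertion_closure_troupe_Int_Branch[of C black]
  have "bij_betw (\<lambda>T. T \<inter> Branch C) {T. troupe C black T} (Pow (Branch C))"
    by (rule bij_betw_byWitness[where f' = "insertion_closure C black"])
      (auto simp: closure branches intro: troupe)
  moreover have "bij_betw (insertion_closure C black) (Pow (Branch C)) {T. troupe C black T}"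
    by (rule bij_betw_byWitness[where f' = "\<lambda>T. T \<inter> Branch C"])
      (auto simp: closure branches intro: troupe)
  ultimately show ?thesis
    using closure branches by blast
qed

end
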